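(* Let points $M_1,\dots,M_N\in\mathbb R^k$ with masses $m_1,\dots,m_N>0$ be given, not all contained in one hyperplane, let $w$ be a line (direction) in $\mathbb R^k$ and let $P\in\mathbb R^k$ be a point. Consider the data ellipsoid at the point $P$, $$\mathcal E_P:\ \langle J_P^{-1}\mathbf x,\mathbf x\rangle=1 .$$ Let the ray from $P$ in the direction $w$ intersect $\mathcal E_P$ at the point $W$, and let $\pi_W$ be the tangent hyperplane to $\mathcal E_P$ at $W$. Then the directional hyperplane of regression in the direction $w$ among the hyperplanes which contain $P$ is parallel to the tangent hyperplane $\pi_W$. In other words, it is the hyperplane conjugate to $PW$ with respect to $\mathcal E_P$.
   Context: The hyperplanar operator of inertia at $P$ is the symmetric operator with $\langle J_P\mathbf n_1,\mathbf n_2\rangle=\sum_{j} m_j\langle \mathbf r_j,\mathbf n_1\rangle\langle\mathbf r_j,\mathbf n_2\rangle$, $\mathbf r_j=M_j-P$. In the equation of $\mathcal E_P$, $\mathbf x$ is the radius vector from $P$ (the ellipsoid is centered at $P$). For a hyperplane $\pi$ not parallel to $w$, the hyperplanar moment of inertia in direction $w$ is $J^w_\pi=\sum_{j=1}^N m_j\hat D_j^2$, where $\hat D_j$ is the distance between $M_j$ and the intersection point of $\pi$ with the line through $M_j$ parallel to $w$. The directional hyperplane of regression in the direction $w$ among the hyperplanes which contain $P$ is the hyperplane minimizing $J^w_\pi$ among all hyperplanes $\pi\ni P$ not parallel to $w$. The hyperplane conjugate to $PW$ with respect to $\mathcal E_P$ is the hyperplane through $P$ consisting of the points with radius vector $\mathbf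 x$ (from $P$) satisfying $\langle J_P^{-1}\mathbf x,\overrightarrow{PW}\rangle=0$. *)

theory Defs
  imports "HOL-Analysis.Analysis"
begin

definition hyperplane :: "'a::euclidean_space set \<Rightarrow> bool" where
  "hyperplane \<pi> \<longleftrightarrow> (\<exists>n c. n \<noteq> 0 \<and> \<pi> = {x. n \<bullet> x = c})"

definition line_in_dir :: "'a::euclidean_space \<Rightarrow> 'a \<Rightarrow> 'a set" where
  "line_in_dir A w = {A + t *\<^sub>R w | t. t \<in> (UNIV :: real set)}"

definition ray_in_dir :: "'a::euclidean_space \<Rightarrow> 'a \<Rightarrow> 'a set" where
  "ray_in_dir A w = {A + t *\<^sub>R w | t. t \<ge> (0::real)}"

definition parallel_to_dir :: "'a::euclidean_space set \<Rightarrow> 'a \<Rightarrow> bool" where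
  "parallel_to_dir \<pi> w \<longleftrightarrow> (\<forall>x\<in>\<pi>. line_in_dir x w \<subseteq> \<pi>)"

text \<open>The operator J_P. The two lemmas below show that this formula gives the unique
  operator with the bilinear form sum_j m_j (r_j . n1) (r_j . n2), where r_j = M_j - P.\<close>

definition inertia_op ::
    "nat \<Rightarrow> (nat \<Rightarrow> real) \<Rightarrow> (nat \<Rightarrow> 'a::euclidean_space) \<Rightarrow> 'a \<Rightarrow> 'a \<Rightarrow> 'a" where
  "inertia_op N m M P x = (\<Sum>j=1..N. (m j * ((M j - P) \<bullet> x)) *\<^sub>R (M j - P))"

lemma inertia_op_inner:
  "inertia_op N m M P n1 \<bullet> n2 = (\<Sum>j=1..N. m j * ((M j - P) \<bullet> n1) * ((M j - P) \<bullet> n2))"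
  by (simp add: inertia_op_def inner_sum_left)

lemma inertia_op_unique:
  assumes "\<And>n1 n2. A n1 \<bullet> n2 = (\<Sum>j=1..N. m j * ((M j - P) \<bullet> n1) * ((M j - P) \<bullet> n2))"
  shows "A = inertia_op N m M P"
proof
  fix x
  have "A x \<bullet> y = inertia_op N m M P x \<bullet> y" for y
    by (simp only: assms inertia_op_inner)
  then show "A x = inertia_op N m M P x"
    using vector_eq_rdot by blast
qed

lemma linear_inertia_op: "linear (inertia_op N m M P)"
  by (rule linearI)
    (simp_all add: inertia_op_def inner_add_right distrib_left scaleR_add_left sum.distrib
      scaleR_sum_right mult.left_commute)

text \<open>Under the standing assumptions the operator is invertible, so that \<open>inv\<close> below is its
  genuine two-sided inverse.\<close>

lemma bij_inertia_op:
  assumes "\<forall>j\<in>{1..N}. m j > 0"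
    and "\<not> (\<exists>\<pi>. hyperplane \<pi> \<and> (\<forall>j\<in>{1..N}. M j \<in> \<pi>))"
  shows "bij (inertia_op N m M P)"
proof -
  have "x = 0" if "inertia_op N m M P x = 0" for x
  proof (rule ccontr)
    assume "x \<noteq> 0"
    have "(\<Sum>j=1..N. m j * ((M j - P) \<bullet> x) * ((M j - P) \<bullet> x)) = 0"
      using that inertia_op_inner[of N m M P x x] by simp
    then have "\<forall>j\<in>{1..N}. m j * ((M j - P) \<bullet> x) * ((M j - P) \<bullet> x) = 0"
      using assms(1)
      by (subst (asm) sum_nonneg_eq_0_iff) (auto simp: mult.assoc intro!: mult_nonneg_nonneg[OF less_imp_le zero_le_square])
    then have "\<forall>j\<in>{1..N}. (M j - P) \<bullet> x = 0"
      using assms(1) by fastforce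
    then have "\<forall>j\<in>{1..N}. M j \<in> {y. x \<bullet> y = x \<bullet> P}"
      by (simp add: inner_diff_left inner_commute[of x])
    with \<open>x \<noteq> 0\<close> assms(2) show False
      unfolding hyperplane_def by blast
  qed
  then have "inj (inertia_op N m M P)"
    using linear_inertia_op linear_injective_0 by blast
  then show ?thesis
    by (simp add: bij_def linear_injective_imp_surjective[OF linear_inertia_op])
qed

definition data_ellipsoid ::
    "nat \<Rightarrow> (nat \<Rightarrow> real) \<Rightarrow> (nat \<Rightarrow> 'a::euclidean_space) \<Rightarrow> 'a \<Rightarrow> 'a set" where
  "data_ellipsoid N m M P = {X. inv (inertia_op N m M P) (X - P) \<bullet> (X - P) = 1}"

definition conjugate_hyperplane ::
    "nat \<Rightarrow> (nat \<Rightarrow> real) \<Rightarrow> (nat \<Rightarrow> 'a::euclidean_space) \<Rightarrow> 'a \<Rightarrow> 'a \<Rightarrow> 'a set" where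
  "conjugate_hyperplane N m M P W = {X. inv (inertia_op N m M P) (X - P) \<bullet> (W - P) = 0}"

text \<open>The points W + v, for v a velocity at W of a curve lying in S. A curve
  defined only near the parameter 0 may be extended by the constant W, so requiring it to
  be defined on the whole real line is no restriction.\<close>

definition tangent_at :: "'a::euclidean_space set \<Rightarrow> 'a \<Rightarrow> 'a set" where
  "tangent_at S W = {W + v | v. \<exists>\<gamma> :: real \<Rightarrow> 'a.
     range \<gamma> \<subseteq> S \<and> \<gamma> 0 = W \<and> (\<gamma> has_vector_derivative v) (at 0)}"

text \<open>Meaningful for w nonzero and \<open>\<pi>\<close> a hyperplane not parallel to w: then the
  intersection point Q exists and is unique.\<close>

definition dir_dist :: "'a::euclidean_space \<Rightarrow> 'a set \<Rightarrow> 'a \<Rightarrow> real" where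
  "dir_dist w \<pi> A = dist A (THE Q. Q \<in> \<pi> \<and> Q \<in> line_in_dir A w)"

definition dir_moment ::
    "nat \<Rightarrow> (nat \<Rightarrow> real) \<Rightarrow> (nat \<Rightarrow> 'a::euclidean_space) \<Rightarrow> 'a \<Rightarrow> 'a set \<Rightarrow> real" where
  "dir_moment N m M w \<pi> = (\<Sum>j=1..N. m j * (dir_dist w \<pi> (M j))\<^sup>2)"

definition dir_regression_hyperplane ::
    "nat \<Rightarrow> (nat \<Rightarrow> real) \<Rightarrow> (nat \<Rightarrow> 'a::euclidean_space) \<Rightarrow> 'a \<Rightarrow> 'a \<Rightarrow> 'a set \<Rightarrow> bool" where
  "dir_regression_hyperplane N m M P w \<pi> \<longleftrightarrow>
     hyperplane \<pi> \<and> P \<in> \<pi> \<and> \<not> parallel_to_dir \<pi> w \<and>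
     (\<forall>\<sigma>. hyperplane \<sigma> \<and> P \<in> \<sigma> \<and> \<not> parallel_to_dir \<sigma> w \<longrightarrow>
        dir_moment N m M w \<pi> \<le> dir_moment N m M w \<sigma>)"

end

theory Submission
  imports Defs
begin

text \<open>
  A hyperplane through \<open>P\<close> with normal \<open>n\<close>, not parallel to \<open>w\<close>, has directional moment
  \<open>\<parallel>w\<parallel>\<^sup>2 \<langle>J n, n\<rangle> / \<langle>n, w\<rangle>\<^sup>2\<close>, where \<open>J\<close> is the operator of inertia at \<open>P\<close>
  (\<open>dir_moment_hyperplane\<close>). Since the points do not lie in one hyperplane, \<open>J\<close> is positive
  definite, and with \<open>u = J\<^sup>-\<^sup>1 w\<close> the number \<open>\<langle>n, w\<rangle>\<close> is the scalar product of \<open>n\<close> and \<open>u\<close>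
  for the form \<open>\<langle>J x, y\<rangle>\<close>. The Cauchy--Schwarz inequality for this form
  (\<open>cauchy_schwarz_op\<close>, \<open>cauchy_schwarz_op_eq\<close>) therefore says that the moment is smallest
  exactly when \<open>n\<close> is a multiple of \<open>J\<^sup>-\<^sup>1 w\<close>: there is one regression hyperplane, and its
  normal is \<open>J\<^sup>-\<^sup>1 w\<close> (\<open>dir_regression_hyperplane_iff\<close>).

  On the other side, \<open>J\<^sup>-\<^sup>1 (W - P)\<close> is half the gradient at \<open>W\<close> of the quadratic function
  defining the ellipsoid, hence a normal of the tangent hyperplane (\<open>tangent_at_ellipsoid\<close>),
  and by the symmetry of \<open>J\<^sup>-\<^sup>1\<close> it is also a normal of the conjugate hyperplane of \<open>PW\<close>. As
  \<open>W - P\<close> is a positive multiple of \<open>w\<close>, all three hyperplanes have the same normal direction.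
\<close>

section \<open>Positive definite symmetric operators\<close>

locale pos_def_op =
  fixes J :: "'a::euclidean_space \<Rightarrow> 'a"
  assumes lin: "linear J"
    and sym: "J x \<bullet> y = x \<bullet> J y"
    and pos: "x \<noteq> 0 \<Longrightarrow> J x \<bullet> x > 0"
begin

lemma bij_op: "bij J"
proof -
  have "inj J"
    using pos by (force simp: linear_injective_0[OF lin])
  then show ?thesis
    by (simp add: bij_def linear_injective_imp_surjective[OF lin])
qed

lemma op_inv [simp]: "J (inv J x) = x"
  by (simp add: bij_op bij_is_surj surj_f_inv_f)

lemma pos_def_inv: "pos_def_op (inv J)"
proof (rule pos_def_op.intro)
  show "linear (inv J)"
    by (simp add: bij_op inj_linear_imp_inv_linear lin bij_is_inj)
  show "inv J x \<bullet> y = x \<bullet> inv J y" for x y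
    using sym[of "inv J x" "inv J y"] by simp
  show "inv J x \<bullet> x > 0" if "x \<noteq> 0" for x
  proof -
    have "inv J x \<noteq> 0"
      using that linear_0[OF lin] op_inv by metis
    then show ?thesis
      using pos[of "inv J x"] by (simp add: inner_commute)
  qed
qed

lemma nonneg: "J x \<bullet> x \<ge> 0"
  using pos[of x] by (cases "x = 0") auto

text \<open>The error term is the value of the form at the component of \<open>n\<close> that is
  \<open>J\<close>-orthogonal to \<open>inv J w\<close>; both the inequality and its equality case are read off from it.\<close>

lemma cauchy_schwarz_op_gap:
  fixes n w :: 'a
  assumes "w \<noteq> 0"
  defines "u \<equiv> inv J w"
  defines "z \<equiv> n - ((n \<bullet> w) / (u \<bullet> w)) *\<^sub>R u"
  shows "J n \<bullet> n = (n \<bullet> w)\<^sup>2 / (u \<bullet> w) + J z \<bullet> z"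
proof -
  interpret I: pos_def_op "inv J" by (rule pos_def_inv)
  have q: "u \<bullet> w > 0" using I.pos assms(1) by (simp add: u_def)
  have Ju: "J u = w" by (simp add: u_def)
  have "J n \<bullet> u = n \<bullet> w" using sym[of n u] Ju by simp
  then show ?thesis
    using q unfolding z_def
    by (simp add: linear_diff[OF lin] linear_scale[OF lin] Ju inner_diff_left inner_diff_right
        inner_commute[of w] power2_eq_square)
qed

lemma cauchy_schwarz_op:
  assumes "w \<noteq> 0"
  shows "(n \<bullet> w)\<^sup>2 / (inv J w \<bullet> w) \<le> J n \<bullet> n"
  by (subst cauchy_schwarz_op_gap[OF assms]) (simp add: nonneg)

lemma cauchy_schwarz_op_eq:
  assumes "w \<noteq> 0" and "J n \<bullet> n \<le> (n \<bullet> w)\<^sup>2 / (inv J w \<bullet> w)"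
  shows "n = ((n \<bullet> w) / (inv J w \<bullet> w)) *\<^sub>R inv J w"
proof (rule ccontr)
  assume "\<not> ?thesis"
  then have "n - ((n \<bullet> w) / (inv J w \<bullet> w)) *\<^sub>R inv J w \<noteq> 0" by simp
  from pos[OF this] cauchy_schwarz_op_gap[OF assms(1), of n] assms(2) show False
    by linarith
qed

section \<open>Tangent hyperplanes and rays of a central ellipsoid\<close>

text \<open>A nonzero tangent vector \<open>v\<close> is realised by the elliptic arc
  \<open>P + cos (\<omega> t) (W - P) + (sin (\<omega> t) / \<omega>) v\<close>: the vectors \<open>W - P\<close> and \<open>v\<close> are conjugate,
  and \<open>\<omega>\<^sup>2 = \<langle>J v, v\<rangle>\<close> makes the arc stay on the ellipsoid. Conversely, differentiating the
  equation along a curve shows that its velocity is orthogonal to \<open>J (W - P)\<close>. For the data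
  ellipsoid, the inverse of the operator of inertia takes the place of \<open>J\<close>.\<close>

lemma tangent_at_ellipsoid:
  fixes P W :: 'a
  defines "E \<equiv> {X. J (X - P) \<bullet> (X - P) = 1}"
  assumes W: "W \<in> E"
  shows "tangent_at E W = {X. J (W - P) \<bullet> X = J (W - P) \<bullet> W}"
proof -
  have bl: "bounded_linear J" using lin by (simp add: linear_conv_bounded_linear)
  have "J (W - P) \<bullet> v = 0"
    if \<gamma>: "range \<gamma> \<subseteq> E" "\<gamma> 0 = W" "(\<gamma> has_vector_derivative v) (at 0)" for \<gamma> :: "real \<Rightarrow> 'a" and v
  proof -
    have d: "((\<lambda>t. \<gamma> t - P) has_derivative (\<lambda>h. h *\<^sub>R v)) (at 0)"
      using \<gamma>(3) unfolding has_vector_derivative_def by (auto intro!: derivative_eq_intros)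
    have "((\<lambda>t. J (\<gamma> t - P) \<bullet> (\<gamma> t - P)) has_derivative
        (\<lambda>h. J (\<gamma> 0 - P) \<bullet> (h *\<^sub>R v) + J (h *\<^sub>R v) \<bullet> (\<gamma> 0 - P))) (at 0)"
      by (rule has_derivative_inner[OF bounded_linear.has_derivative[OF bl d] d])
    moreover have "(\<lambda>t. J (\<gamma> t - P) \<bullet> (\<gamma> t - P)) = (\<lambda>t. 1)"
      using \<gamma>(1) by (auto simp: E_def)
    ultimately have "((\<lambda>t::real. 1::real) has_derivative
        (\<lambda>h. J (W - P) \<bullet> (h *\<^sub>R v) + J (h *\<^sub>R v) \<bullet> (W - P))) (at 0)"
      using \<gamma>(2) by simp
    then have "(\<lambda>h. J (W - P) \<bullet> (h *\<^sub>R v) + J (h *\<^sub>R v) \<bullet> (W - P)) = (\<lambda>h::real. 0)"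
      by (rule has_derivative_unique[OF _ has_derivative_const])
    from fun_cong[OF this, of 1] show ?thesis
      using sym[of v "W - P"] by (simp add: inner_commute)
  qed
  moreover have "\<exists>\<gamma>::real \<Rightarrow> 'a. range \<gamma> \<subseteq> E \<and> \<gamma> 0 = W \<and> (\<gamma> has_vector_derivative v) (at 0)"
    if v: "J (W - P) \<bullet> v = 0" for v
  proof (cases "v = 0")
    case True
    then show ?thesis using W by (intro exI[of _ "\<lambda>_. W"]) auto
  next
    case False
    define r where "r = W - P"
    define \<omega> where "\<omega> = sqrt (J v \<bullet> v)"
    define \<gamma> where "\<gamma> t = P + (cos (\<omega> * t) *\<^sub>R r + (sin (\<omega> * t) / \<omega>) *\<^sub>R v)" for t
    have \<omega>: "\<omega> > 0" "J v \<bullet> v = \<omega>\<^sup>2"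
      using pos[OF False] by (auto simp: \<omega>_def)
    have r: "J r \<bullet> r = 1" "J r \<bullet> v = 0" "J v \<bullet> r = 0"
      using W v sym[of v r] by (auto simp: E_def r_def inner_commute)
    have "\<gamma> t \<in> E" for t
    proof -
      have "J (\<gamma> t - P) \<bullet> (\<gamma> t - P) = (cos (\<omega> * t))\<^sup>2 + (sin (\<omega> * t))\<^sup>2"
        using \<omega>(1) unfolding \<gamma>_def
        by (simp add: linear_add[OF lin] linear_scale[OF lin] inner_add_left inner_add_right
            r \<omega>(2) power2_eq_square)
      then show ?thesis by (simp add: E_def)
    qed
    moreover have "(\<gamma> has_vector_derivative v) (at 0)"
      unfolding \<gamma>_def using \<omega>(1)
      by (auto intro!: derivative_eq_intros simp: has_vector_derivative_def)
    ultimately show ?thesis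
      by (intro exI[of _ \<gamma>]) (auto simp: \<gamma>_def r_def)
  qed
  ultimately have "tangent_at E W = {W + v | v. J (W - P) \<bullet> v = 0}"
    unfolding tangent_at_def by blast
  also have "\<dots> = {X. J (W - P) \<bullet> X = J (W - P) \<bullet> W}"
  proof (intro set_eqI iffI)
    fix X assume "X \<in> {X. J (W - P) \<bullet> X = J (W - P) \<bullet> W}"
    then show "X \<in> {W + v | v. J (W - P) \<bullet> v = 0}"
      by (auto intro!: exI[of _ "X - W"] simp: inner_diff_right)
  qed (auto simp: inner_add_right)
  finally show ?thesis .
qed

lemma ray_inter_ellipsoid:
  assumes "w \<noteq> 0"
  shows "ray_in_dir P w \<inter> {X. J (X - P) \<bullet> (X - P) = 1} = {P + (1 / sqrt (J w \<bullet> w)) *\<^sub>R w}"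
proof -
  have q: "J w \<bullet> w > 0" by (rule pos[OF assms])
  have "t * (t * (J w \<bullet> w)) = 1 \<longleftrightarrow> t = 1 / sqrt (J w \<bullet> w)" if "t \<ge> 0" for t
  proof -
    have "t * (t * (J w \<bullet> w)) = (t * sqrt (J w \<bullet> w))\<^sup>2"
      using q by (simp add: power_mult_distrib power2_eq_square)
    moreover have "t * sqrt (J w \<bullet> w) \<ge> 0" using that q by simp
    ultimately have "t * (t * (J w \<bullet> w)) = 1 \<longleftrightarrow> t * sqrt (J w \<bullet> w) = 1"
      by (simp add: power2_eq_1_iff)
    then show ?thesis using q by (simp add: field_simps)
  qed
  then show ?thesis
    using q by (auto simp: ray_in_dir_def linear_scale[OF lin])
qed

end

section \<open>Directional moments of hyperplanes\<close>

lemma parallel_to_dir_hyperplane: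
  fixes n w P :: "'a::euclidean_space"
  shows "parallel_to_dir {x. n \<bullet> x = n \<bullet> P} w \<longleftrightarrow> n \<bullet> w = 0"
proof
  assume "parallel_to_dir {x. n \<bullet> x = n \<bullet> P} w"
  then have "line_in_dir P w \<subseteq> {x. n \<bullet> x = n \<bullet> P}"
    by (simp add: parallel_to_dir_def)
  moreover have "P + 1 *\<^sub>R w \<in> line_in_dir P w"
    unfolding line_in_dir_def by blast
  ultimately show "n \<bullet> w = 0"
    by (auto simp: inner_add_right)
qed (auto simp: parallel_to_dir_def line_in_dir_def inner_add_right)

lemma hyperplane_through_iff:
  "hyperplane \<pi> \<and> P \<in> \<pi> \<longleftrightarrow> (\<exists>n. n \<noteq> 0 \<and> \<pi> = {x. n \<bullet> x = n \<bullet> P})"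
  unfolding hyperplane_def by auto

lemma dir_dist_hyperplane:
  fixes n w A P :: "'a::euclidean_space"
  assumes "n \<bullet> w \<noteq> 0"
  shows "dir_dist w {x. n \<bullet> x = n \<bullet> P} A = \<bar>((A - P) \<bullet> n) / (n \<bullet> w)\<bar> * norm w"
proof -
  define t where "t = - (((A - P) \<bullet> n) / (n \<bullet> w))"
  have "n \<bullet> (A + s *\<^sub>R w) = n \<bullet> P \<longleftrightarrow> s = t" for s
    using assms
    by (auto simp: t_def inner_commute[of _ n] inner_add_right inner_diff_right field_simps)
  then have "(THE Q. Q \<in> {x. n \<bullet> x = n \<bullet> P} \<and> Q \<in> line_in_dir A w) = A + t *\<^sub>R w"
    by (intro the_equality) (auto simp: line_in_dir_def)
  then show ?thesis
    by (simp add: dir_dist_def dist_norm t_def)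
qed

lemma dir_moment_hyperplane:
  fixes n w P :: "'a::euclidean_space"
  assumes "n \<bullet> w \<noteq> 0"
  shows "dir_moment N m M w {x. n \<bullet> x = n \<bullet> P} =
    (norm w)\<^sup>2 * ((inertia_op N m M P n \<bullet> n) / (n \<bullet> w)\<^sup>2)"
  unfolding dir_moment_def dir_dist_hyperplane[OF assms] inertia_op_inner
  by (simp add: sum_distrib_left sum_divide_distrib power_mult_distrib power_divide
      power2_eq_square mult_ac)

section \<open>The regression hyperplane\<close>

text \<open>Positivity is a consequence of injectivity: for \<open>x \<noteq> 0\<close> the image of \<open>x\<close> is nonzero, so
  some \<open>M j - P\<close> is not orthogonal to \<open>x\<close> and contributes a positive term to the form.\<close>

lemma pos_def_inertia_op:
  assumes "\<forall>j\<in>{1..N}. m j > 0"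
    and "\<not> (\<exists>\<pi>. hyperplane \<pi> \<and> (\<forall>j\<in>{1..N}. M j \<in> \<pi>))"
  shows "pos_def_op (inertia_op N m M P)"
proof (rule pos_def_op.intro)
  show "linear (inertia_op N m M P)" by (rule linear_inertia_op)
  show "inertia_op N m M P x \<bullet> y = x \<bullet> inertia_op N m M P y" for x y
    by (simp add: inertia_op_inner inner_commute[of x] mult_ac)
  show "inertia_op N m M P x \<bullet> x > 0" if "x \<noteq> 0" for x
  proof -
    have "inertia_op N m M P x \<noteq> 0"
      using bij_inertia_op[OF assms, of P] that linear_0[OF linear_inertia_op, of N m M P]
      by (metis bij_is_inj injD)
    then obtain j where j: "j \<in> {1..N}" "(M j - P) \<bullet> x \<noteq> 0"
      unfolding inertia_op_def by (force intro: sum.neutral)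
    show ?thesis
      unfolding inertia_op_inner mult.assoc
    proof (rule sum_pos2[OF _ j(1)])
      show "0 < m j * ((M j - P) \<bullet> x * ((M j - P) \<bullet> x))"
        using assms(1) j by (auto simp: zero_less_mult_iff linorder_neq_iff)
    qed (use assms(1) in \<open>auto simp: less_imp_le\<close>)
  qed
qed

lemma hyperplane_scale_normal:
  fixes n P :: "'a::real_inner"
  assumes "c \<noteq> 0"
  shows "{x. (c *\<^sub>R n) \<bullet> x = (c *\<^sub>R n) \<bullet> P} = {x. n \<bullet> x = n \<bullet> P}"
  using assms by simp

text \<open>The moment of the hyperplane with normal \<open>n\<close> is the reciprocal of the Cauchy--Schwarz
  quotient \<open>\<langle>n, w\<rangle>\<^sup>2 / \<langle>J n, n\<rangle>\<close> up to the factor \<open>\<parallel>w\<parallel>\<^sup>2\<close>; the quotient has its maximum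
  \<open>\<langle>u, w\<rangle>\<close> at the multiples of \<open>u\<close> only, and these all define the same hyperplane.\<close>

lemma dir_regression_hyperplane_iff:
  fixes w P :: "'a::euclidean_space"
  assumes "pos_def_op (inertia_op N m M P)" and "w \<noteq> 0"
  defines "u \<equiv> inv (inertia_op N m M P) w"
  shows "dir_regression_hyperplane N m M P w \<pi> \<longleftrightarrow> \<pi> = {x. u \<bullet> x = u \<bullet> P}"
proof -
  let ?J = "inertia_op N m M P"
  let ?H = "\<lambda>n. {x. n \<bullet> x = n \<bullet> P}"
  interpret pos_def_op ?J by fact
  interpret I: pos_def_op "inv ?J" by (rule pos_def_inv)
  have q: "u \<bullet> w > 0" using I.pos assms(2) by (simp add: u_def)
  then have u: "u \<noteq> 0" "u \<bullet> w \<noteq> 0" by auto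
  have w: "(norm w)\<^sup>2 > 0" using assms(2) by simp
  have "?J u \<bullet> u = u \<bullet> w" by (simp add: u_def inner_commute)
  then have moment_u: "dir_moment N m M w (?H u) = (norm w)\<^sup>2 * (1 / (u \<bullet> w))"
    using q by (simp add: dir_moment_hyperplane[OF u(2)] power2_eq_square)
  have regr: "dir_regression_hyperplane N m M P w \<pi> \<longleftrightarrow>
    (\<exists>n. n \<bullet> w \<noteq> 0 \<and> \<pi> = ?H n \<and>
      (\<forall>n'. n' \<bullet> w \<noteq> 0 \<longrightarrow> dir_moment N m M w (?H n) \<le> dir_moment N m M w (?H n')))" for \<pi>
  proof -
    have *: "hyperplane \<sigma> \<and> P \<in> \<sigma> \<and> \<not> parallel_to_dir \<sigma> w \<longleftrightarrow>
        (\<exists>n. n \<bullet> w \<noteq> 0 \<and> \<sigma> = ?H n)" for \<sigma>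
      using hyperplane_through_iff[of \<sigma> P] parallel_to_dir_hyperplane[of _ P w]
      by (metis inner_zero_left)
    show ?thesis
      unfolding dir_regression_hyperplane_def using * by (smt (verit))
  qed
  have min_u: "dir_moment N m M w (?H u) \<le> dir_moment N m M w (?H n)" if "n \<bullet> w \<noteq> 0" for n
  proof -
    have "1 / (u \<bullet> w) \<le> (?J n \<bullet> n) / (n \<bullet> w)\<^sup>2"
      using cauchy_schwarz_op[OF assms(2), of n] that q by (simp add: u_def field_simps)
    then show ?thesis
      unfolding moment_u dir_moment_hyperplane[OF that] by (rule mult_left_mono) simp
  qed
  show ?thesis
  proof
    assume "dir_regression_hyperplane N m M P w \<pi>"
    then obtain n where n: "n \<bullet> w \<noteq> 0" "\<pi> = ?H n"
      "dir_moment N m M w (?H n) \<le> dir_moment N m M w (?H u)"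
      using u(2) unfolding regr by blast
    from n(3) have "(?J n \<bullet> n) / (n \<bullet> w)\<^sup>2 \<le> 1 / (u \<bullet> w)"
      unfolding moment_u dir_moment_hyperplane[OF n(1)] using w by (simp only: mult_le_cancel_left_pos)
    then have "?J n \<bullet> n \<le> (n \<bullet> w)\<^sup>2 / (u \<bullet> w)"
      using n(1) q by (simp add: field_simps)
    then have "n = ((n \<bullet> w) / (u \<bullet> w)) *\<^sub>R u"
      unfolding u_def by (rule cauchy_schwarz_op_eq[OF assms(2)])
    moreover have "(n \<bullet> w) / (u \<bullet> w) \<noteq> 0" using n(1) u(2) by simp
    ultimately show "\<pi> = ?H u"
      using n(2) hyperplane_scale_normal by metis
  next
    assume "\<pi> = ?H u"
    then show "dir_regression_hyperplane N m M P w \<pi>"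
      unfolding regr using min_u u(2) by blast
  qed
qed

theorem theorem5p4:
  fixes N :: nat and m :: "nat \<Rightarrow> real" and M :: "nat \<Rightarrow> real ^ 'k" and w P :: "real ^ 'k"
  assumes "\<forall>j\<in>{1..N}. m j > 0"
    and "\<not> (\<exists>\<pi>. hyperplane \<pi> \<and> (\<forall>j\<in>{1..N}. M j \<in> \<pi>))"
    and "w \<noteq> 0"
  shows "(\<exists>!W. W \<in> ray_in_dir P w \<inter> data_ellipsoid N m M P) \<and>
    (\<exists>!\<pi>. dir_regression_hyperplane N m M P w \<pi>) \<and>
    (\<forall>W \<pi>. W \<in> ray_in_dir P w \<inter> data_ellipsoid N m M P \<and>
        dir_regression_hyperplane N m M P w \<pi> \<longrightarrow>
      hyperplane (tangent_at (data_ellipsoid N m M P) W) \<and>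
      affine_parallel \<pi> (tangent_at (data_ellipsoid N m M P) W) \<and>
      \<pi> = conjugate_hyperplane N m M P W)"
proof -
  let ?B = "inv (inertia_op N m M P)"
  define u where "u = ?B w"
  define s where "s = 1 / sqrt (u \<bullet> w)"
  have pd: "pos_def_op (inertia_op N m M P)"
    using assms(1,2) by (rule pos_def_inertia_op)
  interpret I: pos_def_op ?B
    using pd by (rule pos_def_op.pos_def_inv)
  have q: "u \<bullet> w > 0" using I.pos[OF assms(3)] by (simp add: u_def)
  then have s: "s \<noteq> 0" and u: "u \<noteq> 0" by (auto simp: s_def)
  have ray: "ray_in_dir P w \<inter> data_ellipsoid N m M P = {P + s *\<^sub>R w}"
    unfolding data_ellipsoid_def s_def u_def by (rule I.ray_inter_ellipsoid[OF assms(3)])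
  have regr: "dir_regression_hyperplane N m M P w \<pi> \<longleftrightarrow> \<pi> = {x. u \<bullet> x = u \<bullet> P}" for \<pi>
    unfolding u_def by (rule dir_regression_hyperplane_iff[OF pd assms(3)])
  define W where "W = P + s *\<^sub>R w"
  have W: "W \<in> data_ellipsoid N m M P" using ray by (auto simp: W_def)
  have normal: "?B (W - P) = s *\<^sub>R u"
    by (simp add: W_def u_def linear_scale[OF I.lin])
  have tangent: "tangent_at (data_ellipsoid N m M P) W = {x. u \<bullet> x = u \<bullet> W}"
    using I.tangent_at_ellipsoid[of W P] W s unfolding data_ellipsoid_def normal
    by (simp add: hyperplane_scale_normal)
  have "hyperplane {x. u \<bullet> x = u \<bullet> W}"
    using u unfolding hyperplane_def by blast
  moreover have "affine_parallel {x. u \<bullet> x = u \<bullet> P} {x. u \<bullet> x = u \<bullet> W}"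
  proof -
    have "{x. u \<bullet> x = u \<bullet> W} = (\<lambda>x. (W - P) + x) ` {x. u \<bullet> x = u \<bullet> P}"
    proof (intro set_eqI iffI)
      fix x assume "x \<in> {x. u \<bullet> x = u \<bullet> W}"
      then show "x \<in> (\<lambda>x. (W - P) + x) ` {x. u \<bullet> x = u \<bullet> P}"
        by (intro image_eqI[of _ _ "x - (W - P)"]) (auto simp: inner_diff_right)
    qed (auto simp: inner_add_right inner_diff_right)
    then show ?thesis unfolding affine_parallel_def by blast
  qed
  moreover have "conjugate_hyperplane N m M P W = {x. u \<bullet> x = u \<bullet> P}"
    using s unfolding conjugate_hyperplane_def I.sym normal
    by (auto simp: inner_commute[of _ u] inner_diff_right)
  ultimately show ?thesis
    unfolding ray regr W_def[symmetric] using tangent by auto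
qed

end
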